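(* The one-dimensional subalgebras of ${\rm A}_1$ are exactly $\langle e_1\rangle$, $\langle e_2\rangle$ and $\langle \alpha e_2+e_3\rangle$ ($\alpha\in\mathbb{C}$). Up to automorphisms of ${\rm A}_1$, every one-dimensional subalgebra of ${\rm A}_1$ is equivalent to $\langle e_1\rangle$ or $\langle e_2\rangle$.
   Context: ${\rm A}_1$ is the complex algebra with basis $e_1,e_2,e_3$ whose only nonzero products of basis elements are $e_1e_i=e_ie_1=e_i$ ($i=1,2,3$) (it carries the involution $\overline{e_1}=e_1,\overline{e_2}=e_2,\overline{e_3}=-e_3$, which plays no role here). A subalgebra is a linear subspace closed under multiplication (it need not contain $e_1$). Two subalgebras are equivalent up to automorphisms if one is mapped onto the other by an algebra automorphism (invertible linear map $\varphi$ with $\varphi(xy)=\varphi(x)\varphi(y)$). $\langle S\rangle$ denotes the linear span of $S$. *)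

theory Defs
  imports "HOL-Analysis.Analysis"
begin

text \<open>The algebra A1 realised on complex^3; coordinates w.r.t. the basis e1,e2,e3.
  Complex-linear structure via the library interpretation vec (scalar mult *s).\<close>

definition e1 :: "complex ^ 3" where "e1 = axis 1 1"
definition e2 :: "complex ^ 3" where "e2 = axis 2 1"
definition e3 :: "complex ^ 3" where "e3 = axis 3 1"

text \<open>Bilinear product with e1 e_i = e_i e1 = e_i and all other basis products zero.\<close>
definition A1_mult :: "complex ^ 3 \<Rightarrow> complex ^ 3 \<Rightarrow> complex ^ 3" where
  "A1_mult x y = vector [x$1 * y$1, x$1 * y$2 + x$2 * y$1, x$1 * y$3 + x$3 * y$1]"

definition A1_subalgebra :: "(complex ^ 3) set \<Rightarrow> bool" where
  "A1_subalgebra S \<longleftrightarrow> vec.subspace S \<and> (\<forall>x\<in>S. \<forall>y\<in>S. A1_mult x y \<in> S)"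

definition A1_automorphism :: "(complex ^ 3 \<Rightarrow> complex ^ 3) \<Rightarrow> bool" where
  "A1_automorphism \<phi> \<longleftrightarrow> Vector_Spaces.linear (*s) (*s) \<phi> \<and> bij \<phi> \<and>
     (\<forall>x y. \<phi> (A1_mult x y) = A1_mult (\<phi> x) (\<phi> y))"

definition A1_equiv :: "(complex ^ 3) set \<Rightarrow> (complex ^ 3) set \<Rightarrow> bool" where
  "A1_equiv S T \<longleftrightarrow> (\<exists>\<phi>. A1_automorphism \<phi> \<and> \<phi> ` S = T)"

end

theory Submission
  imports Defs
begin

text \<open>A line \<open>\<langle>v\<rangle>\<close> is a subalgebra iff \<open>v\<^sup>2 = k v\<close> for some scalar \<open>k\<close>. Since
  \<open>v\<^sup>2 = (v\<^sub>1\<^sup>2, 2 v\<^sub>1 v\<^sub>2, 2 v\<^sub>1 v\<^sub>3)\<close>, either \<open>v\<^sub>1 \<noteq> 0\<close>, which forces \<open>k = v\<^sub>1\<close> and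
  \<open>v\<^sub>2 = v\<^sub>3 = 0\<close>, or \<open>v\<close> lies in \<open>\<langle>e\<^sub>2, e\<^sub>3\<rangle>\<close> and can be normalised to \<open>e\<^sub>2\<close> or
  \<open>\<alpha> e\<^sub>2 + e\<^sub>3\<close>. As \<open>\<langle>e\<^sub>2, e\<^sub>3\<rangle>\<close> is an ideal with zero multiplication, every linear
  automorphism of it extended by \<open>e\<^sub>1 \<mapsto> e\<^sub>1\<close> is an algebra automorphism, and one
  of them sends \<open>\<alpha> e\<^sub>2 + e\<^sub>3\<close> to \<open>e\<^sub>2\<close>.\<close>

lemma (in vector_space) span_singleton_scale:
  assumes "c \<noteq> 0"
  shows "span {scale c x} = span {x}"
proof -
  have "x = scale (inverse c) (scale c x)"
    using assms by simp
  then have "x \<in> span {scale c x}"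
    by (metis span_base span_scale singletonI)
  then show ?thesis
    unfolding span_eq by (auto intro: span_base span_scale)
qed

lemma (in vector_space) dim_1_span_singletonE:
  assumes "subspace S" and "dim S = 1"
  obtains v where "v \<noteq> 0" and "S = span {v}"
proof -
  obtain B where B: "B \<subseteq> S" "independent B" "S \<subseteq> span B" "card B = dim S"
    by (rule basis_exists)
  then obtain v where "B = {v}"
    using assms(2) card_1_singletonE by metis
  with B have "v \<noteq> 0" "S = span {v}"
    using assms(1) dependent_zero span_minimal by blast+
  then show thesis
    by (rule that)
qed

lemma A1_mult_nth [simp]:
  "A1_mult x y $ 1 = x$1 * y$1"
  "A1_mult x y $ 2 = x$1 * y$2 + x$2 * y$1"
  "A1_mult x y $ 3 = x$1 * y$3 + x$3 * y$1"
  by (simp_all add: A1_mult_def)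

lemma A1_basis_nth [simp]:
  "e1$1 = 1" "e1$2 = 0" "e1$3 = 0"
  "e2$1 = 0" "e2$2 = 1" "e2$3 = 0"
  "e3$1 = 0" "e3$2 = 0" "e3$3 = 1"
  by (simp_all add: e1_def e2_def e3_def axis_def)

lemma A1_subalgebra_span_singleton_iff:
  "A1_subalgebra (vec.span {v}) \<longleftrightarrow> (\<exists>k. A1_mult v v = k *s v)"
proof
  assume "A1_subalgebra (vec.span {v})"
  then have "A1_mult v v \<in> vec.span {v}"
    unfolding A1_subalgebra_def by (simp add: vec.span_base)
  then show "\<exists>k. A1_mult v v = k *s v"
    by (auto simp: vec.span_singleton)
next
  assume "\<exists>k. A1_mult v v = k *s v"
  then obtain k where k: "A1_mult v v = k *s v" ..
  have "A1_mult (a *s v) (b *s v) = (a * b * k) *s v" for a b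
    using k by (auto simp: vec_eq_iff forall_3 algebra_simps)
  then have "\<forall>x\<in>vec.span {v}. \<forall>y\<in>vec.span {v}. A1_mult x y \<in> vec.span {v}"
    by (auto simp: vec.span_singleton)
  then show "A1_subalgebra (vec.span {v})"
    unfolding A1_subalgebra_def by simp
qed

lemma A1_line_subalgebra_cases:
  assumes "v \<noteq> 0" and "A1_mult v v = k *s v"
  shows "vec.span {v} = vec.span {e1} \<or> vec.span {v} = vec.span {e2} \<or>
         (\<exists>\<alpha>. vec.span {v} = vec.span {\<alpha> *s e2 + e3})"
proof -
  have eq1: "v$1 * v$1 = k * v$1" and eq2: "2 * v$1 * v$2 = k * v$2"
    and eq3: "2 * v$1 * v$3 = k * v$3"
    using assms(2) unfolding vec_eq_iff forall_3 by (auto simp: algebra_simps)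
  consider "v$1 \<noteq> 0" | "v$1 = 0" "v$3 = 0" | "v$1 = 0" "v$3 \<noteq> 0"
    by blast
  then show ?thesis
  proof cases
    case 1
    with eq1 eq2 eq3 have "v$2 = 0" "v$3 = 0"
      by auto
    then have "v = v$1 *s e1"
      by (simp add: vec_eq_iff forall_3)
    with 1 show ?thesis
      by (metis vec.span_singleton_scale)
  next
    case 2
    then have "v = v$2 *s e2"
      by (simp add: vec_eq_iff forall_3)
    with assms(1) show ?thesis
      by (metis vec.span_singleton_scale vector_smult_lzero)
  next
    case 3
    then have "v = v$3 *s ((v$2 / v$3) *s e2 + e3)"
      by (simp add: vec_eq_iff forall_3)
    with 3 show ?thesis
      by (metis vec.span_singleton_scale)
  qed
qed

lemma A1_one_dim_subalgebra_iff:
  "A1_subalgebra S \<and> vec.dim S = 1 \<longleftrightarrow>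
   S = vec.span {e1} \<or> S = vec.span {e2} \<or> (\<exists>\<alpha>. S = vec.span {\<alpha> *s e2 + e3})"
proof
  assume S: "A1_subalgebra S \<and> vec.dim S = 1"
  then obtain v where "v \<noteq> 0" and v: "S = vec.span {v}"
    unfolding A1_subalgebra_def by (metis vec.dim_1_span_singletonE)
  moreover obtain k where "A1_mult v v = k *s v"
    using S v A1_subalgebra_span_singleton_iff by blast
  ultimately show "S = vec.span {e1} \<or> S = vec.span {e2} \<or>
                   (\<exists>\<alpha>. S = vec.span {\<alpha> *s e2 + e3})"
    using A1_line_subalgebra_cases by blast
next
  have "e1 \<noteq> 0" "e2 \<noteq> 0" "\<alpha> *s e2 + e3 \<noteq> 0" for \<alpha>
    by (auto simp: vec_eq_iff forall_3)
  moreover have "A1_mult e1 e1 = 1 *s e1" "A1_mult e2 e2 = 0 *s e2"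
    "A1_mult (\<alpha> *s e2 + e3) (\<alpha> *s e2 + e3) = 0 *s (\<alpha> *s e2 + e3)" for \<alpha>
    by (auto simp: vec_eq_iff forall_3)
  moreover assume "S = vec.span {e1} \<or> S = vec.span {e2} \<or>
                   (\<exists>\<alpha>. S = vec.span {\<alpha> *s e2 + e3})"
  ultimately show "A1_subalgebra S \<and> vec.dim S = 1"
    using A1_subalgebra_span_singleton_iff by (metis vec.dim_span vec.dim_singleton)
qed

definition A1_aut_line_to_e2 :: "complex \<Rightarrow> complex ^ 3 \<Rightarrow> complex ^ 3" where
  "A1_aut_line_to_e2 \<alpha> x = vector [x$1, x$3, x$2 - \<alpha> * x$3]"

lemma A1_aut_line_to_e2_nth [simp]:
  "A1_aut_line_to_e2 \<alpha> x $ 1 = x$1"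
  "A1_aut_line_to_e2 \<alpha> x $ 2 = x$3"
  "A1_aut_line_to_e2 \<alpha> x $ 3 = x$2 - \<alpha> * x$3"
  by (simp_all add: A1_aut_line_to_e2_def)

lemma A1_automorphism_aut_line_to_e2: "A1_automorphism (A1_aut_line_to_e2 \<alpha>)"
  unfolding A1_automorphism_def
proof (intro conjI allI)
  show "Vector_Spaces.linear (*s) (*s) (A1_aut_line_to_e2 \<alpha>)"
    unfolding Vector_Spaces.linear_iff
    by (auto simp: vec.vector_space_axioms vec_eq_iff forall_3 algebra_simps)
  define g :: "complex ^ 3 \<Rightarrow> complex ^ 3" where "g x = vector [x$1, x$3 + \<alpha> * x$2, x$2]" for x
  have "g \<circ> A1_aut_line_to_e2 \<alpha> = id" "A1_aut_line_to_e2 \<alpha> \<circ> g = id"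
    by (auto simp: g_def fun_eq_iff vec_eq_iff forall_3)
  then show "bij (A1_aut_line_to_e2 \<alpha>)"
    using o_bij by blast
  show "A1_aut_line_to_e2 \<alpha> (A1_mult x y) =
        A1_mult (A1_aut_line_to_e2 \<alpha> x) (A1_aut_line_to_e2 \<alpha> y)" for x y
    by (auto simp: vec_eq_iff forall_3 algebra_simps)
qed

lemma A1_aut_line_to_e2_image: "A1_aut_line_to_e2 \<alpha> ` vec.span {\<alpha> *s e2 + e3} = vec.span {e2}"
proof -
  have "A1_aut_line_to_e2 \<alpha> (k *s (\<alpha> *s e2 + e3)) = k *s e2" for k
    by (auto simp: vec_eq_iff forall_3)
  then show ?thesis
    unfolding vec.span_singleton image_image by simp
qed

lemma A1_equiv_refl: "A1_equiv S S"
  unfolding A1_equiv_def A1_automorphism_def by (auto intro!: exI[of _ id] vec.linear_id)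

theorem mainTheorem4:
  shows "(\<forall>S. (A1_subalgebra S \<and> vec.dim S = 1) \<longleftrightarrow>
            (S = vec.span {e1} \<or> S = vec.span {e2} \<or>
             (\<exists>\<alpha>::complex. S = vec.span {\<alpha> *s e2 + e3})))
       \<and> (\<forall>S. A1_subalgebra S \<and> vec.dim S = 1 \<longrightarrow>
            A1_equiv S (vec.span {e1}) \<or> A1_equiv S (vec.span {e2}))"
proof (intro conjI allI impI)
  show "A1_subalgebra S \<and> vec.dim S = 1 \<longleftrightarrow>
        S = vec.span {e1} \<or> S = vec.span {e2} \<or> (\<exists>\<alpha>. S = vec.span {\<alpha> *s e2 + e3})" for S
    by (rule A1_one_dim_subalgebra_iff)
next
  fix S
  assume "A1_subalgebra S \<and> vec.dim S = 1"
  then consider "S = vec.span {e1}" | "S = vec.span {e2}" | \<alpha> where "S = vec.span {\<alpha> *s e2 + e3}"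
    using A1_one_dim_subalgebra_iff by blast
  then show "A1_equiv S (vec.span {e1}) \<or> A1_equiv S (vec.span {e2})"
  proof cases
    case 3
    then show ?thesis
      using A1_automorphism_aut_line_to_e2 A1_aut_line_to_e2_image unfolding A1_equiv_def by blast
  qed (simp_all add: A1_equiv_refl)
qed

end
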